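(* The kernel of the prelie algebra morphism $\phi_{PL}:\mathfrak{g}_{\mathcal{T}(\mathbb{N}^* )}\to\mathbb{K}\langle x_0,x_1\rangle$ is the prelie ideal generated by: 1. $B_1(t_1\ldots t_k)$, where $k\ge1$, $t_1,\ldots,t_k\in\mathcal{T}(\mathbb{N}^* )$; 2. $B_{n+1}\bigl(B_i(s_1\ldots s_k)B_j(t_1\ldots t_l)\bigr)-B_n\bigl(B_{i+1}(s_1\ldots s_kB_j(t_1\ldots t_l))+B_{j+1}(B_i(s_1\ldots s_k)t_1\ldots t_l)\bigr)$, where $i,j,n\ge1$, $k,l\ge0$, $s_1,\ldots,s_k,t_1,\ldots,t_l\in\mathcal{T}(\mathbb{N}^* )$.
   Context: All vector spaces are over a field $\mathbb{K}$ of characteristic zero; $\mathbb{N}^*$ is the set of positive integers. A (right) prelie algebra is a vector space with a bilinear product $\bullet$ such that $(x\bullet y)\bullet z-x\bullet(y\bullet z)=(x\bullet z)\bullet y-x\bullet(z\bullet y)$. A prelie ideal of $A$ is a subspace $I$ with $I\bullet A\subseteq I$ and $A\bullet I\subseteq I$. $\mathcal{T}(\mathbb{N}^* )$ is the set of (isoclasses of) rooted trees whose vertices are decorated by elements of $\mathbb{N}^*$, and $\mathfrak{g}_{\mathcal{T}(\mathbb{N}^* )}$ is the vector space with basis $\mathcal{T}(\mathbb{N}^* )$, with the product $t\bullet t'=\sum_s t\bullet_s t'$, summed over all vertices $s$ of $t$, where $t\bullet_st'$ is obtained by grafting the root of $t'$ on $s$. This is the free prelie algebra generated by the one-vertex trees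 $\cdot_n$, $n\in\mathbb{N}^*$. For $n\in\mathbb{N}^*$ and trees $t_1,\ldots,t_k$ ($k\ge0$), $B_n(t_1\ldots t_k)$ is the tree obtained by grafting $t_1,\ldots,t_k$ on a common root decorated by $n$; it is extended multilinearly in $t_1,\ldots,t_k$. On $\mathbb{K}\langle x_0,x_1\rangle$ (span of words, $\emptyset$ the empty word), $\sqcup\!\sqcup$ is the shuffle product, and $\bullet$ is the bilinear prelie product determined by: for all words $c,d$, $\emptyset\bullet d=0$, $(x_0c)\bullet d=x_0(c\bullet d)$, $(x_1c)\bullet d=x_1(c\bullet d)+x_0(c\sqcup\!\sqcup d)$. $\phi_{PL}$ is the unique (surjective) prelie algebra morphism sending $\cdot_n$ to $x_1^{n-1}$ for all $n\ge1$. *)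

theory Defs
  imports Complex_Main "HOL-Library.Multiset" "HOL-Library.Poly_Mapping"
begin

text \<open>
  The vector space over \<open>'k\<close> with basis the elements of \<open>'b\<close> is the type
  \<open>'b \<Rightarrow>\<^sub>0 'k\<close> of finitely supported functions.
\<close>

definition scale :: "'k::field \<Rightarrow> ('b \<Rightarrow>\<^sub>0 'k) \<Rightarrow> ('b \<Rightarrow>\<^sub>0 'k)"
  where "scale c p = Poly_Mapping.map ((*) c) p"

lemma lookup_scale [simp]: "Poly_Mapping.lookup (scale c p) b = c * Poly_Mapping.lookup p b"
  by (simp add: scale_def Poly_Mapping.map.rep_eq when_def)

global_interpretation vs: vector_space scale
  by unfold_locales (auto intro!: poly_mapping_eqI simp: lookup_add algebra_simps)

definition basis :: "'b \<Rightarrow> ('b \<Rightarrow>\<^sub>0 'k::field)"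
  where "basis b = Poly_Mapping.single b 1"

definition lin_ext :: "('b \<Rightarrow> ('c \<Rightarrow>\<^sub>0 'k::field)) \<Rightarrow> ('b \<Rightarrow>\<^sub>0 'k) \<Rightarrow> ('c \<Rightarrow>\<^sub>0 'k)"
  where "lin_ext f p = (\<Sum>b\<in>Poly_Mapping.keys p. scale (Poly_Mapping.lookup p b) (f b))"

definition bilin_ext ::
    "('a \<Rightarrow> 'b \<Rightarrow> ('c \<Rightarrow>\<^sub>0 'k::field)) \<Rightarrow> ('a \<Rightarrow>\<^sub>0 'k) \<Rightarrow> ('b \<Rightarrow>\<^sub>0 'k) \<Rightarrow> ('c \<Rightarrow>\<^sub>0 'k)"
  where "bilin_ext f p q =
    (\<Sum>a\<in>Poly_Mapping.keys p. \<Sum>b\<in>Poly_Mapping.keys q. scale (Poly_Mapping.lookup p a * Poly_Mapping.lookup q b) (f a b))"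

definition prelie_ideal ::
    "(('b \<Rightarrow>\<^sub>0 'k::field) \<Rightarrow> ('b \<Rightarrow>\<^sub>0 'k) \<Rightarrow> ('b \<Rightarrow>\<^sub>0 'k)) \<Rightarrow> ('b \<Rightarrow>\<^sub>0 'k) set \<Rightarrow> bool"
  where "prelie_ideal m I \<longleftrightarrow>
    vs.subspace I \<and> (\<forall>x\<in>I. \<forall>y. m x y \<in> I) \<and> (\<forall>x. \<forall>y\<in>I. m x y \<in> I)"

definition prelie_morphism ::
    "(('b \<Rightarrow>\<^sub>0 'k::field) \<Rightarrow> ('b \<Rightarrow>\<^sub>0 'k) \<Rightarrow> ('b \<Rightarrow>\<^sub>0 'k)) \<Rightarrow>
     (('c \<Rightarrow>\<^sub>0 'k) \<Rightarrow> ('c \<Rightarrow>\<^sub>0 'k) \<Rightarrow> ('c \<Rightarrow>\<^sub>0 'k)) \<Rightarrow>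
     (('b \<Rightarrow>\<^sub>0 'k) \<Rightarrow> ('c \<Rightarrow>\<^sub>0 'k)) \<Rightarrow> bool"
  where "prelie_morphism m m' f \<longleftrightarrow>
    Vector_Spaces.linear scale scale f \<and> (\<forall>x y. f (m x y) = m' (f x) (f y))"

text \<open>
  Isoclasses of rooted trees with decorated vertices: since the children of a vertex form a
  multiset, equality in this type is isomorphism of decorated rooted trees.
  The constructor \<open>B n\<close> grafts a multiset of trees on a common root decorated by \<open>n\<close>;
  \<open>B n {#}\<close> is a one-vertex tree. The library type \<open>num\<close> of positive
  numerals serves as the set of positive integers.
\<close>

datatype 'd rtree = B 'd "'d rtree multiset"

text \<open>
  \<open>graft t t'\<close> is the multiset of all trees obtained by grafting the root of \<open>t'\<close> on a
  vertex \<open>s\<close> of \<open>t\<close>, one occurrence for each \<open>s\<close>: either \<open>s\<close> is the root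
  of \<open>t\<close>, or it is a vertex of one of the subtrees of the root.
\<close>

function graft :: "'d rtree \<Rightarrow> 'd rtree \<Rightarrow> 'd rtree multiset"
  where "graft (B n ts) t' =
    add_mset (B n (add_mset t' ts))
      (\<Sum>u\<in>#ts. image_mset (\<lambda>v. B n (add_mset v (ts - {#u#}))) (graft u t'))"
  by pat_completeness auto
termination
  by (relation "measure (\<lambda>(t, _). size t)")
    (auto simp: size_multiset_overloaded_eq dest!: multi_member_split)

definition tree_prod ::
    "('d rtree \<Rightarrow>\<^sub>0 'k::field) \<Rightarrow> ('d rtree \<Rightarrow>\<^sub>0 'k) \<Rightarrow> ('d rtree \<Rightarrow>\<^sub>0 'k)"
  where "tree_prod = bilin_ext (\<lambda>t t'. \<Sum>u\<in>#graft t t'. basis u)"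

definition B_lin :: "'d \<Rightarrow> ('d rtree \<Rightarrow>\<^sub>0 'k::field) \<Rightarrow> ('d rtree \<Rightarrow>\<^sub>0 'k)"
  where "B_lin n = lin_ext (\<lambda>t. basis (B n {#t#}))"

datatype letter = X0 | X1

definition cons_lin :: "letter \<Rightarrow> (letter list \<Rightarrow>\<^sub>0 'k::field) \<Rightarrow> (letter list \<Rightarrow>\<^sub>0 'k)"
  where "cons_lin a = lin_ext (\<lambda>w. basis (a # w))"

text \<open>
  The library's \<open>shuffles\<close> is a set and loses the multiplicities of the shuffle product.
\<close>

fun shuffle_words :: "letter list \<Rightarrow> letter list \<Rightarrow> (letter list \<Rightarrow>\<^sub>0 'k::field)"
  where
    "shuffle_words [] d = basis d"
  | "shuffle_words c [] = basis c"
  | "shuffle_words (a # c) (b # d) =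
       cons_lin a (shuffle_words c (b # d)) + cons_lin b (shuffle_words (a # c) d)"

fun prelie_words :: "letter list \<Rightarrow> letter list \<Rightarrow> (letter list \<Rightarrow>\<^sub>0 'k::field)"
  where
    "prelie_words [] d = 0"
  | "prelie_words (X0 # c) d = cons_lin X0 (prelie_words c d)"
  | "prelie_words (X1 # c) d =
       cons_lin X1 (prelie_words c d) + cons_lin X0 (shuffle_words c d)"

definition word_prod ::
    "(letter list \<Rightarrow>\<^sub>0 'k::field) \<Rightarrow> (letter list \<Rightarrow>\<^sub>0 'k) \<Rightarrow> (letter list \<Rightarrow>\<^sub>0 'k)"
  where "word_prod = bilin_ext prelie_words"

definition gens1 :: "(num rtree \<Rightarrow>\<^sub>0 'k::field) set"
  where "gens1 = {basis (B num.One ts) | ts. ts \<noteq> {#}}"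

definition gens2 :: "(num rtree \<Rightarrow>\<^sub>0 'k::field) set"
  where "gens2 =
    {basis (B (n + num.One) {#B i ss, B j ts#})
       - B_lin n (basis (B (i + num.One) (add_mset (B j ts) ss))
                + basis (B (j + num.One) (add_mset (B i ss) ts)))
     | n i j ss ts. True}"

end

theory Submission
  imports Defs "HOL-Library.List_Lexorder"
begin

text \<open>
  Since \<open>\<bullet>\<close> is a derivation of the shuffle product in its left argument, induction on the
  number of children gives
  \<open>\<phi>(B\<^sub>n\<^sub>+\<^sub>1(t t\<^sub>1 \<dots> t\<^sub>k)) = \<phi>(B\<^sub>n(t\<^sub>1 \<dots> t\<^sub>k)) \<squnion> x\<^sub>0\<phi>(t)\<close>, where \<open>\<squnion>\<close> is the
  shuffle product, and \<open>\<phi>(B\<^sub>1(t\<^sub>1 \<dots> t\<^sub>k)) = 0\<close> for \<open>k \<ge> 1\<close>. Together with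
  \<open>x\<^sub>0u \<squnion> x\<^sub>0v = x\<^sub>0(u \<squnion> x\<^sub>0v + x\<^sub>0u \<squnion> v)\<close> this shows that \<open>\<phi>\<close> kills the generators.

  Conversely, the second family of relations lowers the number of children of the root, so modulo
  the ideal every tree is a combination of ladders whose vertices other than the leaf have
  decoration at least 2. These ladders are indexed by words, and the image of a ladder is its
  word plus lexicographically smaller words, so \<open>\<phi>\<close> is injective on their span.
\<close>

section \<open>Linear and bilinear extensions\<close>

lemma keys_scale: "Poly_Mapping.keys (scale c p) \<subseteq> Poly_Mapping.keys p"
  by (auto simp: in_keys_iff)

lemma lin_ext_eq_sum:
  assumes "finite S" "Poly_Mapping.keys p \<subseteq> S"
  shows "lin_ext f p = (\<Sum>b\<in>S. scale (Poly_Mapping.lookup p b) (f b))"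
  unfolding lin_ext_def using assms
  by (intro sum.mono_neutral_left) (auto simp: in_keys_iff)

lemma lin_ext_add: "lin_ext f (p + q) = lin_ext f p + lin_ext f q"
proof -
  let ?S = "Poly_Mapping.keys p \<union> Poly_Mapping.keys q"
  have *: "Poly_Mapping.keys (p + q) \<subseteq> ?S"
    by (rule Poly_Mapping.keys_add)
  show ?thesis
    using * by (simp add: lin_ext_eq_sum[of ?S] lookup_add vs.scale_left_distrib sum.distrib)
qed

lemma lin_ext_scale: "lin_ext f (scale c p) = scale c (lin_ext f p)"
  using keys_scale[of c p]
  by (simp add: lin_ext_eq_sum[of "Poly_Mapping.keys p"] vs.scale_sum_right)

lemma linear_lin_ext: "Vector_Spaces.linear scale scale (lin_ext f)"
  by unfold_locales (simp_all add: lin_ext_add lin_ext_scale)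

lemma lookup_basis [simp]: "Poly_Mapping.lookup (basis b) b' = (if b = b' then 1 else 0)"
  by (simp add: basis_def lookup_single when_def)

lemma lin_ext_basis: "lin_ext f (basis b :: 'b \<Rightarrow>\<^sub>0 'k::field) = f b"
  by (simp add: lin_ext_def basis_def)

lemma poly_mapping_basis_sum:
  "p = (\<Sum>b\<in>Poly_Mapping.keys p. scale (Poly_Mapping.lookup p b) (basis b))"
  by (rule poly_mapping_eqI)
    (auto simp: lookup_sum in_keys_iff if_distrib cong: if_cong)

text \<open>Identities that are linear in several arguments are checked on words or trees by nesting
  this rule, one use per argument.\<close>

lemma basis_induct [case_names zero add scale basis]:
  fixes p :: "'b \<Rightarrow>\<^sub>0 'k::field"
  assumes "P 0" "\<And>p q. P p \<Longrightarrow> P q \<Longrightarrow> P (p + q)" "\<And>c p. P p \<Longrightarrow> P (scale c p)" "\<And>b. P (basis b)"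
  shows "P p"
proof -
  have "P (\<Sum>b\<in>S. scale (Poly_Mapping.lookup p b) (basis b))" if "finite S" for S
    using that by (induction S) (auto intro: assms)
  then show ?thesis
    using poly_mapping_basis_sum[of p] by (metis finite_keys)
qed

lemma bilin_ext_altdef:
  "bilin_ext f p q = lin_ext (\<lambda>a. lin_ext (f a) q) p"
  by (simp add: bilin_ext_def lin_ext_def vs.scale_sum_right)

lemma lin_ext_fun_add: "lin_ext (\<lambda>a. f a + g a) p = lin_ext f p + lin_ext g p"
  by (simp add: lin_ext_def vs.scale_right_distrib sum.distrib)

lemma lin_ext_fun_scale: "lin_ext (\<lambda>a. scale c (f a)) p = scale c (lin_ext f p)"
  by (simp add: lin_ext_def vs.scale_sum_right mult.commute)

lemma bilin_ext_add_left: "bilin_ext f (p + p') q = bilin_ext f p q + bilin_ext f p' q"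
  and bilin_ext_add_right: "bilin_ext f p (q + q') = bilin_ext f p q + bilin_ext f p q'"
  and bilin_ext_scale_left: "bilin_ext f (scale c p) q = scale c (bilin_ext f p q)"
  and bilin_ext_scale_right: "bilin_ext f p (scale c q) = scale c (bilin_ext f p q)"
  and bilin_ext_basis: "bilin_ext f (basis a) (basis b :: 'b \<Rightarrow>\<^sub>0 'k::field) = f a b"
  by (simp_all add: bilin_ext_altdef lin_ext_add lin_ext_scale lin_ext_fun_add lin_ext_fun_scale
      lin_ext_basis)

lemma linear_bilin_ext_left: "Vector_Spaces.linear scale scale (\<lambda>p. bilin_ext f p q)"
  by unfold_locales (simp_all add: bilin_ext_add_left bilin_ext_scale_left)

lemma linear_bilin_ext_right: "Vector_Spaces.linear scale scale (bilin_ext f p)"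
  by unfold_locales (simp_all add: bilin_ext_add_right bilin_ext_scale_right)

interpretation cons: Vector_Spaces.linear scale scale "cons_lin a"
  unfolding cons_lin_def by (rule linear_lin_ext)

lemma cons_lin_basis [simp]: "cons_lin a (basis w) = basis (a # w)"
  by (simp add: cons_lin_def lin_ext_basis)

section \<open>The shuffle algebra of words\<close>

definition shuffle :: "(letter list \<Rightarrow>\<^sub>0 'k::field) \<Rightarrow> (letter list \<Rightarrow>\<^sub>0 'k) \<Rightarrow> (letter list \<Rightarrow>\<^sub>0 'k)"
  where "shuffle = bilin_ext shuffle_words"

interpretation sh_left: Vector_Spaces.linear scale scale "\<lambda>p. shuffle p q"
  unfolding shuffle_def by (rule linear_bilin_ext_left)

interpretation sh_right: Vector_Spaces.linear scale scale "shuffle p"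
  unfolding shuffle_def by (rule linear_bilin_ext_right)

interpretation wp_left: Vector_Spaces.linear scale scale "\<lambda>p. word_prod p q"
  unfolding word_prod_def by (rule linear_bilin_ext_left)

interpretation wp_right: Vector_Spaces.linear scale scale "word_prod p"
  unfolding word_prod_def by (rule linear_bilin_ext_right)

lemmas word_linear = cons.add cons.scale cons.zero sh_left.add sh_left.scale sh_left.zero
  sh_right.add sh_right.scale sh_right.zero wp_left.add wp_left.scale wp_left.zero
  wp_right.add wp_right.scale wp_right.zero

lemma shuffle_basis: "shuffle (basis c) (basis d) = shuffle_words c d"
  by (simp add: shuffle_def bilin_ext_basis)

lemma word_prod_basis: "word_prod (basis c) (basis d) = prelie_words c d"
  by (simp add: word_prod_def bilin_ext_basis)

lemma shuffle_words_Nil_right [simp]: "shuffle_words c [] = basis c"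
  by (cases c) auto

lemma shuffle_Nil [simp]: "shuffle (basis []) p = p" "shuffle p (basis []) = p"
  by (induction p rule: basis_induct) (simp_all add: word_linear shuffle_basis)

lemma shuffle_cons_cons:
  "shuffle (cons_lin a p) (cons_lin b q) =
    cons_lin a (shuffle p (cons_lin b q)) + cons_lin b (shuffle (cons_lin a p) q)"
proof (induction p rule: basis_induct)
  case (basis c)
  show ?case
    by (induction q rule: basis_induct)
      (simp_all add: word_linear shuffle_basis vs.scale_right_distrib)
qed (simp_all add: word_linear vs.scale_right_distrib)

lemma shuffle_words_commute: "shuffle_words c d = shuffle_words d c"
  by (induction c d rule: shuffle_words.induct) (simp_all add: add.commute)

lemma shuffle_commute: "shuffle p q = shuffle q p"
proof (induction p rule: basis_induct)
  case (basis c)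
  show ?case
    by (induction q rule: basis_induct)
      (simp_all add: word_linear shuffle_basis shuffle_words_commute)
qed (simp_all add: word_linear)

lemma shuffle_basis_assoc:
  "shuffle (shuffle (basis c) (basis d)) (basis e) =
    shuffle (basis c) (shuffle (basis d) (basis e :: letter list \<Rightarrow>\<^sub>0 'k::field))"
proof (induction "length c + length d + length e" arbitrary: c d e rule: less_induct)
  case less
  show ?case
  proof (cases "c = [] \<or> d = [] \<or> e = []")
    case False
    then obtain a c' b d' x e' where *: "c = a # c'" "d = b # d'" "e = x # e'"
      by (metis list.exhaust)
    have IH: "shuffle (shuffle (basis c') (cons_lin b (basis d'))) (cons_lin x (basis e'))
        = (shuffle (basis c') (shuffle (cons_lin b (basis d')) (cons_lin x (basis e'))) :: letter list \<Rightarrow>\<^sub>0 'k)"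
      "shuffle (shuffle (cons_lin a (basis c')) (basis d')) (cons_lin x (basis e'))
        = (shuffle (cons_lin a (basis c')) (shuffle (basis d') (cons_lin x (basis e'))) :: letter list \<Rightarrow>\<^sub>0 'k)"
      "shuffle (shuffle (cons_lin a (basis c')) (cons_lin b (basis d'))) (basis e')
        = (shuffle (cons_lin a (basis c')) (shuffle (cons_lin b (basis d')) (basis e')) :: letter list \<Rightarrow>\<^sub>0 'k)"
      using less[of c' d e] less[of c d' e] less[of c d e'] by (simp_all add: *)
    show ?thesis
      unfolding * cons_lin_basis[symmetric]
      \<comment> \<open>Expanding the inner shuffle splits the left side of the third hypothesis
        into two summands; in the goal each of them stands behind the letter
        \<open>x\<close>.\<close>
      using IH(1,2) arg_cong[OF IH(3), of "cons_lin x"]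
      by (simp add: shuffle_cons_cons word_linear del: cons_lin_basis)
  qed auto
qed

lemma shuffle_assoc: "shuffle (shuffle p q) r = shuffle p (shuffle q r)"
proof (induction p rule: basis_induct)
  case (basis c)
  show ?case
  proof (induction q rule: basis_induct)
    case (basis d)
    show ?case
      by (induction r rule: basis_induct) (simp_all add: word_linear shuffle_basis_assoc)
  qed (simp_all add: word_linear)
qed (simp_all add: word_linear)

lemma word_prod_Nil [simp]: "word_prod (basis []) p = 0"
  by (induction p rule: basis_induct) (simp_all add: word_linear word_prod_basis)

lemma word_prod_cons:
  "word_prod (cons_lin a p) q =
    cons_lin a (word_prod p q) + (if a = X1 then cons_lin X0 (shuffle p q) else 0)"
proof (induction p rule: basis_induct)
  case (basis c)
  show ?case
    by (induction q rule: basis_induct; cases a)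
      (simp_all add: word_linear word_prod_basis shuffle_basis vs.scale_right_distrib)
qed (simp_all add: word_linear vs.scale_right_distrib)

text \<open>Compare first letters. The extra terms with \<open>X0\<close> in front, which a first
  letter \<open>X1\<close> produces, agree on both sides because the shuffle product is associative
  and commutative.\<close>

lemma word_prod_shuffle_basis:
  "word_prod (shuffle (basis c) (basis d)) q =
    shuffle (word_prod (basis c) q) (basis d) + shuffle (basis c) (word_prod (basis d) q)"
proof (induction "length c + length d" arbitrary: c d rule: less_induct)
  case less
  show ?case
  proof (cases "c = [] \<or> d = []")
    case False
    then obtain a c' b d' where *: "c = a # c'" "d = b # d'"
      by (metis list.exhaust)
    have IH: "word_prod (shuffle (basis c') (cons_lin b (basis d'))) q =
        shuffle (word_prod (basis c') q) (cons_lin b (basis d'))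
        + shuffle (basis c') (word_prod (cons_lin b (basis d')) q)"
      "word_prod (shuffle (cons_lin a (basis c')) (basis d')) q =
        shuffle (word_prod (cons_lin a (basis c')) q) (basis d')
        + shuffle (cons_lin a (basis c')) (word_prod (basis d') q)"
      using less[of c' d] less[of c d'] by (simp_all add: *)
    show ?thesis
      unfolding * cons_lin_basis[symmetric]
      using IH by (simp add: shuffle_cons_cons word_prod_cons word_linear shuffle_assoc
          shuffle_commute[of q "cons_lin _ (basis d')"] del: cons_lin_basis)
  qed (auto simp: word_linear)
qed

lemma word_prod_shuffle:
  "word_prod (shuffle p p') q = shuffle (word_prod p q) p' + shuffle p (word_prod p' q)"
proof (induction p rule: basis_induct)
  case (basis c)
  show ?case
    by (induction p' rule: basis_induct)
      (simp_all add: word_linear vs.scale_right_distrib word_prod_shuffle_basis)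
qed (simp_all add: word_linear vs.scale_right_distrib)

text \<open>Both sides satisfy \<open>r (m+1) = X1 r(m) + X0 (X1^(m+1) shuffle q)\<close>. This is
  the childless case of \<open>phi_B_Suc\<close>.\<close>

lemma word_prod_X1_power:
  "word_prod (basis (replicate (Suc m) X1)) q = shuffle (basis (replicate m X1)) (cons_lin X0 q)"
proof (induction m)
  case 0
  show ?case
    using word_prod_cons[of X1 "basis []" q] by (simp add: word_linear)
next
  case (Suc m)
  show ?case
    using Suc word_prod_cons[of X1 "basis (replicate (Suc m) X1)" q]
      shuffle_cons_cons[of X1 "basis (replicate m X1)" X0 q] by simp
qed

section \<open>The prelie algebra of trees\<close>

interpretation tp_left: Vector_Spaces.linear scale scale "\<lambda>p. tree_prod p q"
  unfolding tree_prod_def by (rule linear_bilin_ext_left)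

interpretation tp_right: Vector_Spaces.linear scale scale "tree_prod p"
  unfolding tree_prod_def by (rule linear_bilin_ext_right)

interpretation B_lin: Vector_Spaces.linear scale scale "B_lin n"
  unfolding B_lin_def by (rule linear_lin_ext)

lemma B_lin_basis [simp]: "B_lin n (basis t) = basis (B n {#t#})"
  by (simp add: B_lin_def lin_ext_basis)

declare graft.simps [simp del]

lemma sum_mset_image_sum_mset:
  "(\<Sum>x\<in>#(\<Sum>u\<in>#M. f u). g x :: 'a::comm_monoid_add) = (\<Sum>u\<in>#M. \<Sum>x\<in>#f u. g x)"
  by (induction M) auto

lemma image_mset_sum_mset:
  "image_mset f (\<Sum>u\<in>#M. g u) = (\<Sum>u\<in>#M. image_mset f (g u))"
  by (induction M) auto

lemma tree_prod_basis: "tree_prod (basis t) (basis t') = (\<Sum>u\<in>#graft t t'. basis u)"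
  by (simp add: tree_prod_def bilin_ext_basis)

lemma tree_prod_basis_B:
  "tree_prod (basis (B n ts)) (basis t) = basis (B n (add_mset t ts))
    + (\<Sum>u\<in>#ts. \<Sum>v\<in>#graft u t. basis (B n (add_mset v (ts - {#u#}))))"
  by (simp add: tree_prod_basis graft.simps sum_mset_image_sum_mset image_mset.compositionality
      comp_def)

text \<open>A one-vertex tree offers a single vertex for grafting. As a left multiplication,
  \<open>B_lin n\<close> preserves every prelie ideal.\<close>

lemma B_lin_eq_tree_prod: "B_lin n p = tree_prod (basis (B n {#})) p"
  by (induction p rule: basis_induct)
    (simp_all add: tp_right.add tp_right.scale tp_right.zero B_lin.add B_lin.scale B_lin.zero
      tree_prod_basis_B)

lemma remove_from_add_mset: "u \<in># M \<Longrightarrow> add_mset x M - {#u#} = add_mset x (M - {#u#})"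
  by (auto dest: multi_member_split)

text \<open>Serves inductions on the number of children: only the first tree gains a child at the
  root, so the equation can be solved for it.\<close>

lemma tree_prod_basis_B_add:
  "tree_prod (basis (B n (add_mset s ts))) (basis t) = basis (B n (add_mset t (add_mset s ts)))
    + (\<Sum>v\<in>#graft s t. basis (B n (add_mset v ts)))
    + (\<Sum>u\<in>#ts. \<Sum>v\<in>#graft u t. basis (B n (add_mset v (add_mset s (ts - {#u#})))))"
  by (simp add: tree_prod_basis_B add.assoc remove_from_add_mset cong: image_mset_cong)

lemma num_cases_add [case_names One add_One]:
  obtains "n = num.One" | m where "n = m + num.One"
  by (induction n rule: num_induct) (auto simp: add_One)

section \<open>The kernel contains the generators\<close>

locale tree_word_morphism =
  fixes \<phi> :: "(num rtree \<Rightarrow>\<^sub>0 'k::field_char_0) \<Rightarrow> (letter list \<Rightarrow>\<^sub>0 'k)"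
  assumes morphism: "prelie_morphism tree_prod word_prod \<phi>"
    and phi_root: "\<phi> (basis (B n {#})) = basis (replicate (nat_of_num n - 1) X1)"
begin

sublocale phi: Vector_Spaces.linear scale scale \<phi>
  using morphism by (simp add: prelie_morphism_def)

lemma phi_tree_prod: "\<phi> (tree_prod p q) = word_prod (\<phi> p) (\<phi> q)"
  using morphism by (simp add: prelie_morphism_def)

lemma phi_sum_mset: "\<phi> (\<Sum>x\<in>#M. f x) = (\<Sum>x\<in>#M. \<phi> (f x))"
  by (induction M) (simp_all add: phi.add phi.zero)

lemma phi_graft: "(\<Sum>v\<in>#graft u t. \<phi> (basis v)) = word_prod (\<phi> (basis u)) (\<phi> (basis t))"
  by (simp add: phi_tree_prod[symmetric] tree_prod_basis phi_sum_mset)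

text \<open>The one-vertex tree maps to the empty word, which annihilates from the left. With more
  children, induction kills both the product by \<open>t\<close> and all its terms but the one with
  \<open>t\<close> adjoined to the root, hence that one too.\<close>

lemma phi_B_One: "\<phi> (basis (B num.One (add_mset t ts))) = 0"
proof (induction "size ts" arbitrary: t ts)
  case 0
  have "\<phi> (tree_prod (basis (B num.One {#})) (basis t)) = 0"
    by (simp add: phi_tree_prod phi_root)
  then show ?case
    using 0 by (simp add: tree_prod_basis_B)
next
  case (Suc k)
  then obtain s ss where ts: "ts = add_mset s ss" and k: "size ss = k"
    by (metis size_eq_Suc_imp_eq_union size_add_mset nat.inject)
  have IH: "\<phi> (basis (B num.One (add_mset x ss))) = 0" for x
    using Suc k by simp
  have IH': "\<phi> (basis (B num.One (add_mset x (add_mset y (ss - {#u#}))))) = 0"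
    if "u \<in># ss" for u x y
    using Suc(1)[of "add_mset y (ss - {#u#})"] k that by (auto dest!: multi_member_split)
  have "\<phi> (tree_prod (basis (B num.One (add_mset s ss))) (basis t)) = 0"
    by (simp add: phi_tree_prod IH word_linear)
  then show ?case
    by (simp add: tree_prod_basis_B_add ts phi.add phi_sum_mset IH IH' cong: image_mset_cong)
qed

text \<open>Multiply the tree with children \<open>t\<close> and \<open>ss\<close> by
  \<open>s\<close> and apply the derivation rule to its image. The terms with \<open>s\<close>
  grafted inside \<open>t\<close> or inside \<open>ss\<close> cancel, which leaves the tree with
  \<open>s\<close> adjoined to the root.\<close>

lemma phi_B_Suc:
  "\<phi> (basis (B (n + num.One) (add_mset t ts))) =
    shuffle (\<phi> (basis (B n ts))) (cons_lin X0 (\<phi> (basis t)))"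
proof (induction "size ts" arbitrary: t ts)
  case 0
  obtain m where m: "nat_of_num n = Suc m"
    using nat_of_num_pos[of n] gr0_implies_Suc by blast
  have "\<phi> (basis (B (n + num.One) {#t#})) =
      \<phi> (tree_prod (basis (B (n + num.One) {#})) (basis t))"
    by (simp add: tree_prod_basis_B)
  also have "\<dots> = shuffle (\<phi> (basis (B n {#}))) (cons_lin X0 (\<phi> (basis t)))"
    using word_prod_X1_power[of m "\<phi> (basis t)"]
    by (simp add: phi_tree_prod phi_root nat_of_num_add m)
  finally show ?case
    using 0 by simp
next
  case (Suc k)
  then obtain s ss where ts: "ts = add_mset s ss" and k: "size ss = k"
    by (metis size_eq_Suc_imp_eq_union size_add_mset nat.inject)
  let ?c = "\<lambda>t. cons_lin X0 (\<phi> (basis t))"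
  have IH: "\<phi> (basis (B (n + num.One) (add_mset x ss))) = shuffle (\<phi> (basis (B n ss))) (?c x)" for x
    using Suc k by simp
  \<comment> \<open>The unchanged child \<open>y\<close> is split off and the modified child
    \<open>x\<close> stays in the first factor, so that these terms add up to
    \<open>?R\<close>.\<close>
  have IH': "\<phi> (basis (B (n + num.One) (add_mset x (add_mset y (ss - {#u#}))))) =
      shuffle (\<phi> (basis (B n (add_mset x (ss - {#u#}))))) (?c y)" if "u \<in># ss" for u x y
    using Suc(1)[of "add_mset x (ss - {#u#})" y] k that
    by (auto dest!: multi_member_split simp: add_mset_commute)
  have sum_shuffle: "(\<Sum>x\<in>#M. shuffle (f x) q) = shuffle (\<Sum>x\<in>#M. f x) q"
    for M :: "num rtree multiset" and f q
    by (induction M) (simp_all add: word_linear)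
  have sum_c: "(\<Sum>x\<in>#M. shuffle p (?c x)) = shuffle p (cons_lin X0 (\<Sum>x\<in>#M. \<phi> (basis x)))" for M p
    by (induction M) (simp_all add: word_linear)
  let ?R = "\<Sum>u\<in>#ss. \<Sum>v\<in>#graft u s. \<phi> (basis (B n (add_mset v (ss - {#u#}))))"
  have "\<phi> (tree_prod (basis (B (n + num.One) (add_mset t ss))) (basis s)) =
      \<phi> (basis (B (n + num.One) (add_mset s (add_mset t ss))))
      + shuffle (\<phi> (basis (B n ss))) (cons_lin X0 (word_prod (\<phi> (basis t)) (\<phi> (basis s))))
      + shuffle ?R (?c t)"
    by (simp add: tree_prod_basis_B_add phi.add phi_sum_mset IH IH' sum_shuffle sum_c phi_graft
        cong: image_mset_cong)
  moreover have "word_prod (\<phi> (basis (B n ss))) (\<phi> (basis s)) =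
      \<phi> (basis (B n (add_mset s ss))) + ?R"
    by (simp add: phi_tree_prod[symmetric] tree_prod_basis_B phi.add phi_sum_mset)
  ultimately show ?case
    by (simp add: ts add_mset_commute[of t s] phi_tree_prod IH word_prod_shuffle word_prod_cons word_linear)
qed

lemma phi_gens1: "x \<in> gens1 \<Longrightarrow> \<phi> x = 0"
  by (auto simp: gens1_def phi_B_One dest!: multi_nonempty_split)

lemma phi_gens2:
  assumes "x \<in> gens2"
  shows "\<phi> x = 0"
proof -
  obtain n i j ss ts where x: "x = basis (B (n + num.One) {#B i ss, B j ts#})
       - B_lin n (basis (B (i + num.One) (add_mset (B j ts) ss))
                + basis (B (j + num.One) (add_mset (B i ss) ts)))"
    using assms by (auto simp: gens2_def)
  show ?thesis
  \<comment> \<open>\<open>phi_B_Suc\<close> describes the subtracted trees only for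
    \<open>n = m + 1\<close>; for \<open>n = 1\<close> each of the three trees has image zero by
    itself.\<close>
  proof (cases n rule: num_cases_add)
    case One
    then show ?thesis
      using phi_B_Suc[of num.One "B i ss" "{#B j ts#}"]
      by (simp add: x phi.add phi.diff B_lin.add phi_B_One word_linear)
  next
    case (add_One m)
    let ?u = "\<phi> (basis (B i ss))" and ?v = "\<phi> (basis (B j ts))" and ?p = "\<phi> (basis (B m {#}))"
    have "\<phi> x = shuffle (shuffle ?p (cons_lin X0 ?v)) (cons_lin X0 ?u)
       - (shuffle ?p (cons_lin X0 (shuffle ?u (cons_lin X0 ?v)))
         + shuffle ?p (cons_lin X0 (shuffle ?v (cons_lin X0 ?u))))"
      unfolding x add_One by (simp add: phi.add phi.diff B_lin.add phi_B_Suc)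
    also have "\<dots> = 0"
      by (simp add: shuffle_assoc shuffle_cons_cons word_linear
          shuffle_commute[of ?u] shuffle_commute[of ?v])
    finally show ?thesis .
  qed
qed

lemma prelie_ideal_kernel: "prelie_ideal tree_prod {x. \<phi> x = 0}"
  unfolding prelie_ideal_def
  by (auto simp: phi_tree_prod word_linear phi.subspace_kernel)

end

section \<open>Reduction of trees to ladders modulo the ideal\<close>

primrec incr_root :: "num rtree \<Rightarrow> num rtree"
  where "incr_root (B n ts) = B (n + num.One) ts"

text \<open>By \<open>phi_B_Suc\<close>, the image of \<open>graft_incr u v\<close> is the image of
  \<open>u\<close> shuffled with \<open>X0\<close> times the image of \<open>v\<close>.\<close>

primrec graft_incr :: "num rtree \<Rightarrow> num rtree \<Rightarrow> num rtree"
  where "graft_incr (B i ss) v = B (i + num.One) (add_mset v ss)"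

text \<open>With \<open>ws = {#}\<close> these are the generators of the second family. The others lie in the
  ideal because right multiplication by \<open>t\<close> acts on \<open>gen2 n u v ws\<close> as if \<open>t\<close> were
  adjoined to \<open>ws\<close> or grafted on \<open>u\<close>, \<open>v\<close> or a member of \<open>ws\<close>.\<close>

definition gen2 :: "num \<Rightarrow> num rtree \<Rightarrow> num rtree \<Rightarrow> num rtree multiset \<Rightarrow> (num rtree \<Rightarrow>\<^sub>0 'k::field)"
  where "gen2 n u v ws = basis (B (n + num.One) (add_mset u (add_mset v ws)))
    - basis (B n (add_mset (graft_incr u v) ws)) - basis (B n (add_mset (graft_incr v u) ws))"

lemma gen2_empty: "gen2 n u v {#} \<in> gens2"
proof -
  obtain i ss j ts where uv: "u = B i ss" "v = B j ts"
    by (meson rtree.exhaust)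
  have "gen2 n u v {#} = basis (B (n + num.One) {#B i ss, B j ts#})
       - B_lin n (basis (B (i + num.One) (add_mset (B j ts) ss))
                + basis (B (j + num.One) (add_mset (B i ss) ts)))"
    by (simp add: gen2_def uv B_lin.add)
  then show ?thesis
    unfolding gens2_def by blast
qed

text \<open>The vertices of \<open>graft_incr u v\<close> are those of \<open>u\<close> and those of
  \<open>v\<close>, and grafting ignores the decoration of the root.\<close>

lemma graft_graft_incr:
  "graft (graft_incr u v) t =
    image_mset (\<lambda>u'. graft_incr u' v) (graft u t) + image_mset (graft_incr u) (graft v t)"
proof -
  obtain i ss where u: "u = B i ss"
    by (cases u)
  show ?thesis
    unfolding u graft_incr.simps graft.simps
    by (simp add: image_mset_sum_mset add_mset_commute remove_from_add_mset
        image_mset.compositionality comp_def cong: image_mset_cong)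
qed

lemma gen2_tree_prod:
  "tree_prod (gen2 n u v ws) (basis t) = (gen2 n u v (add_mset t ws) :: num rtree \<Rightarrow>\<^sub>0 'k::field)
    + (\<Sum>u'\<in>#graft u t. gen2 n u' v ws) + (\<Sum>v'\<in>#graft v t. gen2 n u v' ws)
    + (\<Sum>w\<in>#ws. \<Sum>w'\<in>#graft w t. gen2 n u v (add_mset w' (ws - {#w#})))"
proof -
  have sum_diff: "(\<Sum>x\<in>#M. f x - g x) = (\<Sum>x\<in>#M. f x) - (\<Sum>x\<in>#M. g x)"
    for M :: "num rtree multiset" and f g :: "num rtree \<Rightarrow> (num rtree \<Rightarrow>\<^sub>0 'k)"
    by (induction M) auto
  \<comment> \<open>The three products are matched term by term. For \<open>graft_incr v u\<close>
    the sum over \<open>v\<close> precedes the sum over \<open>u\<close>, hence \<open>c2\<close>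
    before \<open>b2\<close>.\<close>
  have regroup: "(a + b + c + d) - (a1 + b1 + c1 + d1) - (a2 + c2 + b2 + d2) =
      (a - a1 - a2) + (b - b1 - b2) + (c - c1 - c2) + (d - d1 - d2)"
    for a b c d a1 b1 c1 d1 a2 b2 c2 d2 :: "num rtree \<Rightarrow>\<^sub>0 'k"
    by (simp add: algebra_simps)
  have 1: "tree_prod (basis (B (n + num.One) (add_mset u (add_mset v ws)))) (basis t) =
      (basis (B (n + num.One) (add_mset u (add_mset v (add_mset t ws)))) :: _ \<Rightarrow>\<^sub>0 'k)
      + (\<Sum>u'\<in>#graft u t. basis (B (n + num.One) (add_mset u' (add_mset v ws))))
      + (\<Sum>v'\<in>#graft v t. basis (B (n + num.One) (add_mset u (add_mset v' ws))))
      + (\<Sum>w\<in>#ws. \<Sum>w'\<in>#graft w t.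
          basis (B (n + num.One) (add_mset u (add_mset v (add_mset w' (ws - {#w#}))))))"
    by (simp add: tree_prod_basis_B_add remove_from_add_mset add_mset_commute add.assoc cong: image_mset_cong)
  have 2: "tree_prod (basis (B n (add_mset (graft_incr x y) ws))) (basis t) =
      (basis (B n (add_mset (graft_incr x y) (add_mset t ws))) :: _ \<Rightarrow>\<^sub>0 'k)
      + (\<Sum>x'\<in>#graft x t. basis (B n (add_mset (graft_incr x' y) ws)))
      + (\<Sum>y'\<in>#graft y t. basis (B n (add_mset (graft_incr x y') ws)))
      + (\<Sum>w\<in>#ws. \<Sum>w'\<in>#graft w t. basis (B n (add_mset (graft_incr x y) (add_mset w' (ws - {#w#})))))"
    for x y
    by (simp add: tree_prod_basis_B_add graft_graft_incr image_mset.compositionality comp_def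
        add_mset_commute add.assoc)
  show ?thesis
    unfolding gen2_def tp_left.diff sum_diff 1 2 by (rule regroup)
qed

section \<open>The ideal generated by both families\<close>

abbreviation generated_ideal :: "(num rtree \<Rightarrow>\<^sub>0 'k::field) set"
  where "generated_ideal \<equiv> prelie_ideal tree_prod hull (gens1 \<union> gens2)"

text \<open>\<open>hull\<close> is the intersection of all ideals containing the generators; this
  closure property makes it an ideal itself.\<close>

lemma prelie_ideal_Inter:
  assumes "\<And>J. J \<in> \<J> \<Longrightarrow> prelie_ideal m J"
  shows "prelie_ideal m (\<Inter>\<J>)"
  using assms unfolding prelie_ideal_def by (auto intro!: vs.subspace_Inter)

lemma prelie_ideal_generated: "prelie_ideal tree_prod generated_ideal"
  by (rule hull_in) (auto intro: prelie_ideal_Inter)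

lemmas subspace_generated = prelie_ideal_generated[THEN prelie_ideal_def[THEN iffD1], THEN conjunct1]
  and tree_prod_generated_left =
    prelie_ideal_generated[THEN prelie_ideal_def[THEN iffD1], THEN conjunct2, THEN conjunct1, rule_format]
  and tree_prod_generated_right =
    prelie_ideal_generated[THEN prelie_ideal_def[THEN iffD1], THEN conjunct2, THEN conjunct2, rule_format]

lemma generated_sum_mset:
  assumes "\<And>x. x \<in># M \<Longrightarrow> f x \<in> generated_ideal"
  shows "(\<Sum>x\<in>#M. f x) \<in> generated_ideal"
  using assms
proof (induction M)
  case empty
  show ?case
    using vs.subspace_0[OF subspace_generated] by simp
next
  case (add x M)
  have "f x \<in> generated_ideal" "(\<Sum>x\<in>#M. f x) \<in> generated_ideal"
    using add by auto
  from vs.subspace_add[OF subspace_generated this] show ?case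
    by simp
qed

text \<open>\<open>gen2_tree_prod\<close> is solved for the term with the extra sibling
  \<open>t\<close>; all other terms have one sibling fewer beside the pair. Grafting alters the pair
  itself, so \<open>u\<close> and \<open>v\<close> stay arbitrary.\<close>

lemma gen2_in_generated: "(gen2 n u v ws :: _ \<Rightarrow>\<^sub>0 'k::field) \<in> generated_ideal"
proof (induction "size ws" arbitrary: u v ws)
  case 0
  then show ?case
    by (auto intro!: hull_inc gen2_empty)
next
  case (Suc k)
  then obtain t ss where ws: "ws = add_mset t ss" and k: "size ss = k"
    by (metis size_eq_Suc_imp_eq_union size_add_mset nat.inject)
  have IH: "(gen2 n x y ss :: _ \<Rightarrow>\<^sub>0 'k) \<in> generated_ideal" for x y
    using Suc k by simp
  have IH': "(gen2 n u v (add_mset x (ss - {#w#})) :: _ \<Rightarrow>\<^sub>0 'k) \<in> generated_ideal"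
    if "w \<in># ss" for w x
    using that k by (intro Suc(1)) (auto dest!: multi_member_split)
  have "(gen2 n u v (add_mset t ss) :: _ \<Rightarrow>\<^sub>0 'k) = tree_prod (gen2 n u v ss) (basis t)
    - (\<Sum>u'\<in>#graft u t. gen2 n u' v ss) - (\<Sum>v'\<in>#graft v t. gen2 n u v' ss)
    - (\<Sum>w\<in>#ss. \<Sum>w'\<in>#graft w t. gen2 n u v (add_mset w' (ss - {#w#})))"
    by (simp add: gen2_tree_prod)
  also have "\<dots> \<in> generated_ideal"
    by (intro vs.subspace_diff generated_sum_mset tree_prod_generated_left IH IH'
        subspace_generated)
  finally show ?case
    by (simp add: ws)
qed

text \<open>The word \<open>x\<^sub>1\<^sup>a x\<^sub>0 x\<^sub>1\<^sup>b x\<^sub>0 \<dots> x\<^sub>0 x\<^sub>1\<^sup>c\<close> encodes the ladder with decorations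
  \<open>a + 2, b + 2, \<dots>, c + 1\<close>.\<close>

fun ladder :: "letter list \<Rightarrow> num rtree"
  where
    "ladder [] = B num.One {#}"
  | "ladder (X1 # w) = incr_root (ladder w)"
  | "ladder (X0 # w) = B (num.One + num.One) {#ladder w#}"

lemma ex_ladder_single: "\<exists>w. ladder w = B n {#}"
proof (induction n rule: num_induct)
  case One
  show ?case by (rule exI[of _ "[]"]) simp
next
  case (inc n)
  then obtain w where "ladder w = B n {#}" by blast
  then have "ladder (X1 # w) = B (Num.inc n) {#}" by (simp add: add_One)
  then show ?case by blast
qed

text \<open>The witness is \<open>X1\<close> repeated \<open>n - 1\<close> times, followed by
  \<open>X0 # w\<close>.\<close>

lemma ex_ladder_B: "\<exists>w'. ladder w' = B (n + num.One) {#ladder w#}"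
proof (induction n rule: num_induct)
  case One
  show ?case by (rule exI[of _ "X0 # w"]) simp
next
  case (inc n)
  then obtain w' where "ladder w' = B (n + num.One) {#ladder w#}" by blast
  then have "ladder (X1 # w') = B (Num.inc n + num.One) {#ladder w#}"
    by (simp add: add_One)
  then show ?case by blast
qed

text \<open>These are the vectors congruent to a combination of ladders modulo the ideal.\<close>

abbreviation reducible :: "(num rtree \<Rightarrow>\<^sub>0 'k::field) set"
  where "reducible \<equiv> vs.span (range (\<lambda>w. basis (ladder w)) \<union> generated_ideal)"

lemma generated_reducible: "x \<in> generated_ideal \<Longrightarrow> x \<in> reducible"
  by (simp add: vs.span_base)

lemma ladder_reducible: "basis (ladder w) \<in> reducible"
  by (simp add: vs.span_base)

lemma B_One_in_generated: "ts \<noteq> {#} \<Longrightarrow> basis (B num.One ts) \<in> generated_ideal"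
  by (rule hull_inc) (auto simp: gens1_def)

text \<open>On the ideal, \<open>B_lin n\<close> acts as a left multiplication. A ladder becomes a
  generator of the first family if \<open>n = 1\<close> and a longer ladder otherwise.\<close>

lemma B_lin_reducible:
  assumes "x \<in> reducible"
  shows "B_lin n x \<in> reducible"
  using assms
proof (induction rule: vs.span_induct_alt)
  case base
  show ?case by (simp add: B_lin.zero vs.span_zero)
next
  case (step c x y)
  have "B_lin n x \<in> reducible"
    using step(1)
  proof
    assume "x \<in> generated_ideal"
    then show ?thesis
      by (simp add: B_lin_eq_tree_prod generated_reducible tree_prod_generated_right)
  next
    assume "x \<in> range (\<lambda>w. basis (ladder w))"
    then obtain w where x: "x = basis (ladder w)" by blast
    show ?thesis
    proof (cases n rule: num_cases_add)
      case One
      then show ?thesis by (simp add: x generated_reducible B_One_in_generated)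
    next
      case (add_One m)
      then show ?thesis
        using ex_ladder_B[of m w] ladder_reducible by (metis x B_lin_basis)
    qed
  qed
  then show ?case
    using step by (simp add: B_lin.add B_lin.scale vs.span_add vs.span_scale)
qed

lemma size_B: "size (B n ts) = Suc (\<Sum>t\<in>#ts. Suc (size t))"
  by (induction ts) auto

text \<open>Induction on the size, then on the number of children of the root. A single child is
  left to \<open>B_lin_reducible\<close>; of several children below a root decorated by
  \<open>m + 1\<close>, the second family merges two and keeps the size.\<close>

lemma basis_reducible: "(basis t :: _ \<Rightarrow>\<^sub>0 'k::field) \<in> reducible"
proof (induction t rule: wf_induct[OF wf_measures, of "[size, \<lambda>t. case t of B n ts \<Rightarrow> size ts]"])
  case (1 t)
  obtain n ts where t: "t = B n ts" by (cases t)
  have IH: "(basis t' :: _ \<Rightarrow>\<^sub>0 'k) \<in> reducible"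
    if "size t' < size t \<or> size t' = size t \<and> (case t' of B n' ts' \<Rightarrow> size ts') < size ts" for t'
    using 1 that t by auto
  consider "ts = {#}" | "ts \<noteq> {#}" "n = num.One" | u where "ts = {#u#}"
    | m u v ws where "n = m + num.One" "ts = add_mset u (add_mset v ws)"
    by (metis multiset_cases num_cases_add)
  then show ?case
  proof cases
    case 1
    then show ?thesis
      using ex_ladder_single[of n] ladder_reducible t by metis
  next
    case 2
    then show ?thesis
      by (simp add: t generated_reducible B_One_in_generated)
  next
    case (3 u)
    then have "B_lin n (basis u :: _ \<Rightarrow>\<^sub>0 'k) \<in> reducible"
      by (intro B_lin_reducible IH) (simp add: t size_B)
    then show ?thesis
      by (simp add: t 3)
  next
    case (4 m u v ws)
    \<comment> \<open>A child contributes \<open>Suc\<close> of its size to the parent, so the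
      merged child contributes as much as the siblings \<open>x\<close> and \<open>y\<close>
      together.\<close>
    have size: "size (graft_incr x y) = Suc (size x + size y)" for x y
      by (cases x) (simp add: size_B)
    have "(basis t :: _ \<Rightarrow>\<^sub>0 'k) = gen2 m u v ws + basis (B m (add_mset (graft_incr u v) ws))
        + basis (B m (add_mset (graft_incr v u) ws))"
      by (simp add: t 4 gen2_def)
    also have "\<dots> \<in> reducible"
      by (intro vs.span_add IH generated_reducible gen2_in_generated)
        (simp_all add: t 4 size_B size)
    finally show ?thesis .
  qed
qed

section \<open>Independence of the images of the ladders\<close>

text \<open>With \<open>X0 < X1\<close>, the lexicographic order puts every word that starts with
  \<open>X0\<close> below every word that starts with \<open>X1\<close>.\<close>

instantiation letter :: linorder
begin

definition "a \<le> b \<longleftrightarrow> a = X0 \<or> b = X1" for a b :: letter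

definition "a < b \<longleftrightarrow> a = X0 \<and> b = X1" for a b :: letter

instance
  by standard (auto simp: less_eq_letter_def less_letter_def intro: letter.exhaust)

end

lemma lookup_cons_lin [simp]:
  "Poly_Mapping.lookup (cons_lin a p) [] = 0"
  "Poly_Mapping.lookup (cons_lin a p) (b # w) = (if a = b then Poly_Mapping.lookup p w else 0)"
  by (induction p rule: basis_induct)
    (auto simp: word_linear lookup_add)

context tree_word_morphism
begin

text \<open>The root of a ladder has at most one child, so the ladder is a one-vertex tree or such a
  tree multiplied by some \<open>t\<close>. Raising the decoration prepends \<open>X1\<close> to the
  image of the vertex, and \<open>word_prod_cons\<close> yields the correction.\<close>

lemma phi_incr_ladder:
  "\<exists>q. \<phi> (basis (incr_root (ladder w))) = cons_lin X1 (\<phi> (basis (ladder w))) + cons_lin X0 q"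
proof -
  have "\<exists>n. ladder w = B n {#} \<or> (\<exists>t. ladder w = B n {#t#})"
    by (induction w rule: ladder.induct) auto
  then consider n where "ladder w = B n {#}" | n t where "ladder w = B n {#t#}"
    by blast
  then show ?thesis
  proof cases
    case 1
    obtain m where "nat_of_num n = Suc m"
      using nat_of_num_pos[of n] gr0_implies_Suc by blast
    then have "\<phi> (basis (incr_root (ladder w))) = cons_lin X1 (\<phi> (basis (ladder w))) + cons_lin X0 0"
      by (simp add: 1 phi_root nat_of_num_add word_linear)
    then show ?thesis ..
  next
    case (2 n t)
    obtain m where m: "nat_of_num n = Suc m"
      using nat_of_num_pos[of n] gr0_implies_Suc by blast
    have single: "basis (B k {#t#}) = tree_prod (basis (B k {#})) (basis t)" for k
      by (simp add: tree_prod_basis_B)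
    have "\<phi> (basis (incr_root (ladder w))) = cons_lin X1 (\<phi> (basis (ladder w)))
        + cons_lin X0 (shuffle (basis (replicate m X1)) (\<phi> (basis t)))"
      using word_prod_cons[of X1 "basis (replicate m X1)"]
      by (simp add: 2 single phi_tree_prod phi_root nat_of_num_add m)
    then show ?thesis ..
  qed
qed

text \<open>Triangularity, letter by letter: prepending \<open>X0\<close> to \<open>w\<close>
  prepends it to the image exactly, and prepending \<open>X1\<close> does so up to words starting
  with \<open>X0\<close>, which are smaller.\<close>

lemma lookup_phi_ladder:
  "Poly_Mapping.lookup (\<phi> (basis (ladder w))) w = 1 \<and>
    (\<forall>v. w < v \<longrightarrow> Poly_Mapping.lookup (\<phi> (basis (ladder w))) v = 0)"
proof (induction w rule: ladder.induct)
  case 1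
  show ?case
    by (auto simp: phi_root)
next
  case (2 w)
  obtain q where "\<phi> (basis (incr_root (ladder w))) = cons_lin X1 (\<phi> (basis (ladder w))) + cons_lin X0 q"
    using phi_incr_ladder by blast
  moreover have "\<exists>v'. v = X1 # v' \<and> w < v'" if "X1 # w < v" for v
    using that by (cases v) (auto simp: less_letter_def)
  ultimately show ?case
    using 2 by (fastforce simp: lookup_add)
next
  case (3 w)
  have "\<phi> (basis (ladder (X0 # w))) = cons_lin X0 (\<phi> (basis (ladder w)))"
    \<comment> \<open>The image of \<open>B num.One {#}\<close> is the empty word, the unit of the
      shuffle product.\<close>
    using phi_B_Suc[of num.One "ladder w" "{#}"] by (simp add: phi_root)
  moreover have "Poly_Mapping.lookup (cons_lin X0 (\<phi> (basis (ladder w)))) v = 0" if "X0 # w < v" for v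
    using that 3 by (cases v) (auto simp: less_letter_def)
  ultimately show ?case
    using 3 by simp
qed

lemma phi_ladders_inj:
  assumes "x \<in> vs.span (range (\<lambda>w. basis (ladder w)))" "\<phi> x = 0"
  shows "x = 0"
proof -
  let ?L = "lin_ext (\<lambda>w. basis (ladder w)) :: (letter list \<Rightarrow>\<^sub>0 'k) \<Rightarrow> _"
  interpret L: Vector_Spaces.linear scale scale ?L
    by (rule linear_lin_ext)
  have "basis (ladder w) \<in> range ?L" for w
    using rangeI[of ?L "basis w"] by (simp add: lin_ext_basis)
  then have "range (\<lambda>w. basis (ladder w)) \<subseteq> range ?L"
    by blast
  moreover have "vs.subspace (range ?L)"
    by (intro L.subspace_image vs.subspace_UNIV)
  ultimately obtain q where x: "x = ?L q"
    using assms(1) vs.span_minimal by blast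
  have "q = 0"
  proof (rule ccontr)
    assume "q \<noteq> 0"
    \<comment> \<open>At the largest word of \<open>q\<close> only its own ladder contributes, since
      the image of any other ladder in the sum has no word above its smaller index.\<close>
    define m where "m = Max (Poly_Mapping.keys q)"
    have m: "m \<in> Poly_Mapping.keys q" "\<And>w. w \<in> Poly_Mapping.keys q \<Longrightarrow> w \<le> m"
      using \<open>q \<noteq> 0\<close> by (auto simp: m_def)
    have "Poly_Mapping.lookup (\<phi> x) m = (\<Sum>w\<in>Poly_Mapping.keys q.
        Poly_Mapping.lookup q w * Poly_Mapping.lookup (\<phi> (basis (ladder w))) m)"
      by (simp add: x lin_ext_def phi.sum phi.scale lookup_sum)
    also have "\<dots> = (\<Sum>w\<in>Poly_Mapping.keys q. if w = m then Poly_Mapping.lookup q m else 0)"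
      using m(2) lookup_phi_ladder by (intro sum.cong) (auto simp: order.strict_iff_order)
    also have "\<dots> \<noteq> 0"
      using m(1) by (simp add: in_keys_iff)
    finally show False
      using assms(2) by simp
  qed
  then show ?thesis
    by (simp add: x L.zero)
qed

section \<open>The two inclusions\<close>

lemma generated_subset_kernel: "generated_ideal \<subseteq> {x. \<phi> x = 0}"
  by (rule hull_minimal) (auto simp: phi_gens1 phi_gens2 prelie_ideal_kernel)

lemma kernel_subset_generated:
  assumes "\<phi> x = 0"
  shows "x \<in> generated_ideal"
proof -
  have "x \<in> reducible"
    by (induction x rule: basis_induct)
      (auto intro: vs.span_zero vs.span_add vs.span_scale basis_reducible)
  \<comment> \<open>The span of a union is the sum of the spans, and the ideal is its own
    span.\<close>
  then obtain y z where x: "x = y + z" and y: "y \<in> vs.span (range (\<lambda>w. basis (ladder w)))"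
    and z: "z \<in> generated_ideal"
    by (auto simp: vs.span_Un vs.span_eq_iff[THEN iffD2, OF subspace_generated])
  have "\<phi> y = 0"
    using assms z generated_subset_kernel by (auto simp: x phi.add)
  then have "y = 0"
    using y phi_ladders_inj by blast
  then show ?thesis
    using z x by simp
qed

end

theorem theorem30:
  fixes \<phi> :: "(num rtree \<Rightarrow>\<^sub>0 'k::field_char_0) \<Rightarrow> (letter list \<Rightarrow>\<^sub>0 'k)"
  assumes "prelie_morphism tree_prod word_prod \<phi>"
    and "\<And>n. \<phi> (basis (B n {#})) = basis (replicate (nat_of_num n - 1) X1)"
  shows "{x. \<phi> x = 0} = prelie_ideal tree_prod hull (gens1 \<union> gens2)"
proof -
  interpret tree_word_morphism \<phi>
    using assms by unfold_locales
  show ?thesis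
    using generated_subset_kernel kernel_subset_generated by blast
qed

end
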